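(* Let $G=(V,E)$ be an infinite, connected, locally finite, simple undirected graph with girth at least $6$. Let $\kappa^*:E\to\mathbb{R}$ be such that there exists $r^*\in\ell^\infty(E)$ with $\kappa(r^* )=\kappa^*$. Let $r(0):E\to\mathbb{R}$ satisfy either (i) $\sup_{e\in E}r_e(0)<\infty$ and $\kappa_e(r(0))\le\kappa^*(e)$ for all $e\in E$, or (ii) $\inf_{e\in E}r_e(0)>-\infty$ and $\kappa_e(r(0))\ge\kappa^*(e)$ for all $e\in E$. Then the solution $r(t)$ of the Ricci flow $$\frac{d}{dt}r(t,e)=-\kappa_e(r(t))+\kappa^*(e),\qquad t>0,\ e\in E,$$ with initial value $r(0)$ converges on every edge, as $t\to\infty$, to some $r(\infty):E\to\mathbb{R}$ with $\kappa(r(\infty))=\kappa^*$, where in case (i) $r_e(\infty)\in\left(-\infty,\ \sup_{e_j\in E}r_j(0)+2\|r^*\|_\infty\right]$ for every $e\in E$, and in case (ii) $r_e(\infty)\in\left[\inf_{e_j\in E}r_j(0)-2\|r^*\|_\infty,\ +\infty\right)$ for every $e\in E$. Moreover the curvature $\kappa_e(r(t))$ converges to $\kappa^*(e)$ for every $e\in E$ as $t\to\infty$.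
   Context: The girth is the length of a shortest cycle ($\infty$ if there is none). For $r:E\to\mathbb{R}$ (so that $\omega=e^{r}$ is a positive edge weight) the Lin-Lu-Yau curvature of an edge $e=(x,y)$ on a graph of girth at least $6$ is $\kappa_e(r)=2\left(\frac{e^{r_{xy}}}{m(x)}+\frac{e^{r_{xy}}}{m(y)}\right)-2$, where $m(x)=\sum_{u\sim x}e^{r_{xu}}$; $\kappa(r)$ denotes the function $e\mapsto\kappa_e(r)$ on $E$. $\ell^\infty(E)$ is the space of bounded real functions on $E$ with supremum norm $\|\cdot\|_\infty$. $r_j$ denotes the value of $r$ at the edge $e_j$. A solution is a family of functions $r(\cdot,e)$, continuous on $[0,\infty)$, satisfying the equation for $t>0$ and the initial condition; on graphs of girth at least $6$ the flow has exactly one solution, defined for all $t\ge0$, for every initial value. *)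

theory Defs
  imports "HOL-Analysis.Analysis" "HOL-Library.Extended_Nat"
begin

text \<open>
  A graph is given by a vertex set and a set of edges, each edge being the set of its two
  endpoints. Functions on edges are total functions on \<open>'a set\<close>; only their values on the
  edge set matter.
\<close>

definition simple_graph :: "'a set \<Rightarrow> 'a set set \<Rightarrow> bool" where
  "simple_graph V E \<longleftrightarrow> (\<forall>e\<in>E. \<exists>x\<in>V. \<exists>y\<in>V. x \<noteq> y \<and> e = {x, y})"

definition neighbours :: "'a set set \<Rightarrow> 'a \<Rightarrow> 'a set" where
  "neighbours E x = {u. {x, u} \<in> E}"

definition locally_finite_graph :: "'a set \<Rightarrow> 'a set set \<Rightarrow> bool" where
  "locally_finite_graph V E \<longleftrightarrow> (\<forall>x\<in>V. finite (neighbours E x))"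

definition connected_graph :: "'a set \<Rightarrow> 'a set set \<Rightarrow> bool" where
  "connected_graph V E \<longleftrightarrow> V \<noteq> {} \<and> (\<forall>x\<in>V. \<forall>y\<in>V. (x, y) \<in> {(u, v). {u, v} \<in> E}\<^sup>*)"

text \<open>
  A cycle is represented by the list of its vertices without repetition of the first one at
  the end, so that its length is the length of the list.
\<close>

definition is_cycle :: "'a set set \<Rightarrow> 'a list \<Rightarrow> bool" where
  "is_cycle E c \<longleftrightarrow> length c \<ge> 3 \<and> distinct c \<and>
     (\<forall>i. Suc i < length c \<longrightarrow> {c ! i, c ! Suc i} \<in> E) \<and> {last c, hd c} \<in> E"

text \<open>The infimum of the empty set in \<^typ>\<open>enat\<close> is \<open>\<infinity>\<close>, as required for acyclic graphs.\<close>

definition girth :: "'a set set \<Rightarrow> enat" where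
  "girth E = (INF c\<in>{c. is_cycle E c}. enat (length c))"

definition vertex_weight :: "'a set set \<Rightarrow> ('a set \<Rightarrow> real) \<Rightarrow> 'a \<Rightarrow> real" where
  "vertex_weight E r x = (\<Sum>u\<in>neighbours E x. exp (r {x, u}))"

text \<open>
  The Lin-Lu-Yau curvature of an edge, in the closed form valid for graphs of girth at least 6.
  The sum ranges over the two endpoints of the edge.
\<close>

definition lly_curvature :: "'a set set \<Rightarrow> ('a set \<Rightarrow> real) \<Rightarrow> 'a set \<Rightarrow> real" where
  "lly_curvature E r e = 2 * (\<Sum>x\<in>e. exp (r e) / vertex_weight E r x) - 2"

lemma lly_curvature_edge:
  assumes "x \<noteq> y"
  shows "lly_curvature E r {x, y} =
    2 * (exp (r {x, y}) / vertex_weight E r x + exp (r {x, y}) / vertex_weight E r y) - 2"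
  using assms by (simp add: lly_curvature_def)

definition linf :: "'b set \<Rightarrow> ('b \<Rightarrow> real) set" where
  "linf E = {f. bounded (f ` E)}"

definition linf_norm :: "'b set \<Rightarrow> ('b \<Rightarrow> real) \<Rightarrow> real" where
  "linf_norm E f = (SUP e\<in>E. \<bar>f e\<bar>)"

definition ricci_flow_solution ::
  "'a set set \<Rightarrow> ('a set \<Rightarrow> real) \<Rightarrow> ('a set \<Rightarrow> real) \<Rightarrow> (real \<Rightarrow> 'a set \<Rightarrow> real) \<Rightarrow> bool" where
  "ricci_flow_solution E \<kappa>s r0 r \<longleftrightarrow>
     (\<forall>e\<in>E. r 0 e = r0 e \<and>
            continuous_on {0..} (\<lambda>t. r t e) \<and>
            (\<forall>t>0. ((\<lambda>s. r s e) has_real_derivative (- lly_curvature E (r t) e + \<kappa>s e)) (at t)))"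

end

theory Submission
  imports Defs
begin

text \<open>
  The flow obeys a comparison principle. If \<open>u - v \<le> M\<close> on all edges, then each ratio
  \<open>exp (u e) / vertex_weight E u x\<close> is at least \<open>exp (u e - v e - M)\<close> times the one of \<open>v\<close>, so
  \<open>w = u - v\<close> satisfies \<open>w' \<le> 4 * (M - w)\<close> for a subsolution \<open>u\<close> and a supersolution \<open>v\<close>. If
  initially \<open>u \<le> v\<close>, a bound \<open>w \<le> M\<close> on \<open>[0, T]\<close> therefore improves itself to
  \<open>w \<le> (1 - exp (- 4 * T)) * M\<close>; iterating gives \<open>u \<le> v\<close>. A first bound is free, since curvatures lie
  in \<open>[-2, 2]\<close>.

  The functions \<open>rs + const\<close> are stationary and bound the flow. Comparing \<open>r\<close> with the constant
  \<open>r0\<close>, and then with its own time shifts, shows that \<open>r\<close> is monotone in time. Hence \<open>r\<close> converges,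
  its time derivative converges as well, and the limit of the derivative must vanish.
\<close>

section \<open>Estimates and continuity of the curvature\<close>

lemma edge_endpointsE:
  assumes "simple_graph V E" "locally_finite_graph V E" "e \<in> E"
  obtains x y where "x \<noteq> y" "e = {x, y}" "finite (neighbours E x)" "finite (neighbours E y)"
proof -
  obtain x y where "x \<in> V" "y \<in> V" "x \<noteq> y" "e = {x, y}"
    using assms(1,3) unfolding simple_graph_def by blast
  then show thesis using assms(2) that unfolding locally_finite_graph_def by simp
qed

lemma exp_le_vertex_weight:
  assumes "finite (neighbours E x)" "{x, y} \<in> E"
  shows "exp (r {x, y}) \<le> vertex_weight E r x"
  unfolding vertex_weight_def using assms
  by (intro member_le_sum[where f="\<lambda>u. exp (r {x, u})"]) (auto simp: neighbours_def)

lemma weight_ratio_bounds: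
  assumes "finite (neighbours E x)" "{x, y} \<in> E"
  shows "0 < vertex_weight E r x"
    and "0 \<le> exp (r {x, y}) / vertex_weight E r x"
    and "exp (r {x, y}) / vertex_weight E r x \<le> 1"
proof -
  note le = exp_le_vertex_weight[OF assms, of r]
  show pos: "0 < vertex_weight E r x"
    using le by (meson exp_gt_zero less_le_trans)
  show "0 \<le> exp (r {x, y}) / vertex_weight E r x" using pos by simp
  show "exp (r {x, y}) / vertex_weight E r x \<le> 1" using pos le by simp
qed

text \<open>With \<open>d\<close> the slack in \<open>u - v \<le> M\<close> at the edge, the ratio
  of \<open>u\<close> is at least \<open>exp (- d)\<close> times the ratio \<open>p\<close> of
  \<open>v\<close>. The tangent bound \<open>exp (- d) \<ge> 1 - d\<close> together with
  \<open>p \<le> 1\<close> makes the loss linear in \<open>d\<close>.\<close>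

lemma weight_ratio_diff_le:
  assumes "finite (neighbours E x)" "{x, y} \<in> E"
    and M: "\<And>e. e \<in> E \<Longrightarrow> u e - v e \<le> M"
  shows "exp (v {x, y}) / vertex_weight E v x - exp (u {x, y}) / vertex_weight E u x
    \<le> M - (u {x, y} - v {x, y})"
proof -
  define p where "p = exp (v {x, y}) / vertex_weight E v x"
  define d where "d = M - (u {x, y} - v {x, y})"
  note pos = weight_ratio_bounds(1)[OF assms(1,2)]
  have p: "0 \<le> p" "p \<le> 1"
    using weight_ratio_bounds[OF assms(1,2)] unfolding p_def by auto
  have d: "0 \<le> d" using M[OF assms(2)] unfolding d_def by simp
  have "vertex_weight E u x \<le> exp M * vertex_weight E v x"
    unfolding vertex_weight_def sum_distrib_left
  proof (rule sum_mono)
    fix z assume "z \<in> neighbours E x"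
    then have "u {x, z} \<le> M + v {x, z}" using M[of "{x, z}"] by (simp add: neighbours_def)
    then show "exp (u {x, z}) \<le> exp M * exp (v {x, z})"
      by (simp flip: exp_add)
  qed
  then have "exp (u {x, y}) / (exp M * vertex_weight E v x) \<le> exp (u {x, y}) / vertex_weight E u x"
    using pos by (intro divide_left_mono) auto
  moreover have "exp (u {x, y}) / (exp M * vertex_weight E v x) = exp (- d) * p"
    by (simp add: p_def d_def exp_diff exp_minus exp_add field_simps)
  moreover have "(1 - d) * p \<le> exp (- d) * p"
    using exp_ge_add_one_self[of "- d"] p(1) by (intro mult_right_mono) auto
  moreover have "d * p \<le> d" using p d by (simp add: mult_left_le)
  ultimately have "p - exp (u {x, y}) / vertex_weight E u x \<le> d"
    by (simp add: algebra_simps)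
  then show ?thesis by (simp add: p_def d_def)
qed

lemma lly_curvature_bounds:
  assumes "simple_graph V E" "locally_finite_graph V E" "e \<in> E"
  shows "- 2 \<le> lly_curvature E r e" and "lly_curvature E r e \<le> 2"
proof -
  obtain x y where xy: "x \<noteq> y" "e = {x, y}" "finite (neighbours E x)" "finite (neighbours E y)"
    using edge_endpointsE[OF assms] .
  have "{x, y} \<in> E" "{y, x} \<in> E" using xy assms(3) by (auto simp: insert_commute)
  note b = weight_ratio_bounds(2,3)[OF xy(3) this(1), of r] weight_ratio_bounds(2,3)[OF xy(4) this(2), of r]
  show "- 2 \<le> lly_curvature E r e" "lly_curvature E r e \<le> 2"
    using b xy by (simp_all add: lly_curvature_edge insert_commute)
qed

text \<open>The constant 4 is the factor 2 of the curvature times the two endpoints, each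
  contributing at most the slack.\<close>

lemma lly_curvature_diff_le:
  assumes "simple_graph V E" "locally_finite_graph V E" "e \<in> E"
    and M: "\<And>e. e \<in> E \<Longrightarrow> u e - v e \<le> M"
  shows "lly_curvature E v e - lly_curvature E u e \<le> 4 * (M - (u e - v e))"
proof -
  obtain x y where xy: "x \<noteq> y" "e = {x, y}" "finite (neighbours E x)" "finite (neighbours E y)"
    using edge_endpointsE[OF assms(1-3)] .
  have "{x, y} \<in> E" "{y, x} \<in> E" using xy assms(3) by (auto simp: insert_commute)
  note b = weight_ratio_diff_le[where u=u and v=v, OF xy(3) this(1) M]
    weight_ratio_diff_le[where u=u and v=v, OF xy(4) this(2) M]
  show ?thesis
    using b xy by (simp add: lly_curvature_edge insert_commute algebra_simps)
qed

text \<open>Numerator and vertex weights all scale by \<open>exp c\<close>. Hence every translate of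
  a stationary function is again stationary.\<close>

lemma lly_curvature_add_const:
  "lly_curvature E (\<lambda>e. r e + c) e = lly_curvature E r e"
  by (simp add: lly_curvature_def vertex_weight_def exp_add flip: sum_distrib_right)

text \<open>Only the edges at the two endpoints enter, finitely many by local finiteness, so
  edgewise convergence suffices without any uniformity. The limiting denominators are
  positive.\<close>

lemma tendsto_lly_curvature:
  assumes "simple_graph V E" "locally_finite_graph V E" "e \<in> E"
    and lim: "\<And>e. e \<in> E \<Longrightarrow> ((\<lambda>t. r t e) \<longlongrightarrow> l e) F"
  shows "((\<lambda>t. lly_curvature E (r t) e) \<longlongrightarrow> lly_curvature E l e) F"
proof -
  obtain x y where xy: "x \<noteq> y" "e = {x, y}" "finite (neighbours E x)" "finite (neighbours E y)"
    using edge_endpointsE[OF assms(1-3)] .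
  have mem: "{x, y} \<in> E" "{y, x} \<in> E" using xy assms(3) by (auto simp: insert_commute)
  have w: "((\<lambda>t. vertex_weight E (r t) z) \<longlongrightarrow> vertex_weight E l z) F" for z
    unfolding vertex_weight_def
    by (intro tendsto_sum tendsto_exp lim) (simp add: neighbours_def)
  have ne: "vertex_weight E l x \<noteq> 0" "vertex_weight E l y \<noteq> 0"
    using weight_ratio_bounds(1)[OF xy(3) mem(1)] weight_ratio_bounds(1)[OF xy(4) mem(2)]
    by (simp_all add: less_imp_neq[symmetric])
  show ?thesis
    unfolding xy(2) lly_curvature_edge[OF xy(1)]
    by (intro tendsto_intros w lim ne mem)
qed

section \<open>Comparison principle for the flow\<close>

lemma relaxation_bound:
  fixes w w' :: "real \<Rightarrow> real"
  assumes cont: "continuous_on {0..T} w"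
    and deriv: "\<And>t. 0 < t \<Longrightarrow> t < T \<Longrightarrow> (w has_real_derivative w' t) (at t)"
    and le: "\<And>t. 0 < t \<Longrightarrow> t < T \<Longrightarrow> w' t \<le> L * (M - w t)"
    and w0: "w 0 \<le> 0" and M: "0 \<le> M" and L: "0 \<le> L" and t: "t \<in> {0..T}"
  shows "w t \<le> (1 - exp (- (L * T))) * M"
proof -
  \<comment> \<open>Integrating factor for \<open>w' \<le> L * (M - w)\<close>: this function is
    nonincreasing and starts at or below \<open>- M\<close>.\<close>
  let ?g = "\<lambda>s. exp (L * s) * (w s - M)"
  have "?g t \<le> ?g 0"
  proof (cases "t = 0")
    case False
    have der: "(?g has_real_derivative exp (L * s) * (w' s - L * (M - w s))) (at s)"
      if "0 < s" "s < t" for s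
      using that t by (auto intro!: derivative_eq_intros deriv simp: algebra_simps)
    show ?thesis
    proof (rule DERIV_nonpos_imp_decreasing_open[where f="?g"])
      show "0 \<le> t" using t by simp
      show "\<exists>y. (?g has_real_derivative y) (at s) \<and> y \<le> 0" if "0 < s" "s < t" for s
        using der[OF that] le[of s] that t
        by (intro exI[of _ "exp (L * s) * (w' s - L * (M - w s))"])
          (auto intro: mult_nonneg_nonpos)
      show "continuous_on {0..t} ?g"
        using t by (intro continuous_intros continuous_on_subset[OF cont]) auto
    qed
  qed simp
  then have "?g t \<le> - M" using w0 by simp
  then have "exp (- (L * t)) * ?g t \<le> exp (- (L * t)) * (- M)"
    by (intro mult_left_mono) auto
  then have "w t \<le> M - exp (- (L * t)) * M"
    by (simp add: mult.assoc[symmetric] flip: exp_add)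
  \<comment> \<open>Passing from \<open>t\<close> to \<open>T\<close> makes the factor uniform on
    the whole interval, as the iteration requires.\<close>
  moreover have "exp (- (L * T)) * M \<le> exp (- (L * t)) * M"
    using t M L by (intro mult_right_mono) (auto intro: mult_left_mono)
  ultimately show ?thesis by (simp add: algebra_simps)
qed

lemma flow_comparison:
  fixes u v u' v' :: "real \<Rightarrow> 'a set \<Rightarrow> real"
  assumes G: "simple_graph V E" "locally_finite_graph V E"
    and cont: "\<And>e. e \<in> E \<Longrightarrow> continuous_on {0..} (\<lambda>t. u t e)"
      "\<And>e. e \<in> E \<Longrightarrow> continuous_on {0..} (\<lambda>t. v t e)"
    and deriv: "\<And>e t. e \<in> E \<Longrightarrow> 0 < t \<Longrightarrow> ((\<lambda>t. u t e) has_real_derivative u' t e) (at t)"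
      "\<And>e t. e \<in> E \<Longrightarrow> 0 < t \<Longrightarrow> ((\<lambda>t. v t e) has_real_derivative v' t e) (at t)"
    and sub: "\<And>e t. e \<in> E \<Longrightarrow> 0 < t \<Longrightarrow> u' t e \<le> - lly_curvature E (u t) e + \<kappa>s e"
    and super: "\<And>e t. e \<in> E \<Longrightarrow> 0 < t \<Longrightarrow> - lly_curvature E (v t) e + \<kappa>s e \<le> v' t e"
    and init: "\<And>e. e \<in> E \<Longrightarrow> u 0 e \<le> v 0 e"
    and "0 \<le> T" "e \<in> E"
  shows "u T e \<le> v T e"
proof -
  define q where "q = 1 - exp (- (4 * T))"
  have q: "0 \<le> q" "q < 1" using \<open>0 \<le> T\<close> by (auto simp: q_def)
  have contw: "continuous_on {0..T'} (\<lambda>t. u t e - v t e)" if "e \<in> E" for e T'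
    using that by (intro continuous_intros continuous_on_subset[OF cont(1)]
        continuous_on_subset[OF cont(2)]) auto
  have derw: "((\<lambda>t. u t e - v t e) has_real_derivative u' t e - v' t e) (at t)"
    if "e \<in> E" "0 < t" for e t
    using that by (intro DERIV_diff deriv)
  have w': "u' t e - v' t e \<le> lly_curvature E (v t) e - lly_curvature E (u t) e"
    if "e \<in> E" "0 < t" for e t
    using sub[OF that] super[OF that] by simp
  have bound: "u t e - v t e \<le> 4 * T * q ^ n" if "e \<in> E" "t \<in> {0..T}" for e t n
    using that
  proof (induction n arbitrary: e t)
    case 0
    \<comment> \<open>Curvatures in \<open>[-2, 2]\<close> differ by at most 4, so
      \<open>u - v\<close> grows at rate at most 4 on every edge.\<close>
    have "u t e - v t e - 4 * t \<le> u 0 e - v 0 e - 4 * 0"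
    proof (rule DERIV_nonpos_imp_decreasing_open[where f="\<lambda>t. u t e - v t e - 4 * t"])
      show "0 \<le> t" using 0 by simp
      show "\<exists>y. ((\<lambda>t. u t e - v t e - 4 * t) has_real_derivative y) (at s) \<and> y \<le> 0"
        if "0 < s" "s < t" for s
      proof (intro exI conjI)
        show "((\<lambda>t. u t e - v t e - 4 * t) has_real_derivative u' s e - v' s e - 4) (at s)"
          using DERIV_diff[OF derw[OF 0(1) \<open>0 < s\<close>] DERIV_cmult_Id[of 4]] by simp
        show "u' s e - v' s e - 4 \<le> 0"
          using w'[OF 0(1) \<open>0 < s\<close>] lly_curvature_bounds(2)[OF G 0(1), of "v s"]
            lly_curvature_bounds(1)[OF G 0(1), of "u s"] by simp
      qed
      show "continuous_on {0..t} (\<lambda>t. u t e - v t e - 4 * t)"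
        by (intro continuous_on_diff[OF contw[OF 0(1)]] continuous_intros)
    qed
    then show ?case using init[OF 0(1)] 0(2) by simp
  next
    case (Suc n)
    have "u t e - v t e \<le> (1 - exp (- (4 * T))) * (4 * T * q ^ n)"
    proof (rule relaxation_bound[OF contw derw])
      fix s assume s: "0 < s" "s < T"
      have "lly_curvature E (v s) e - lly_curvature E (u s) e
        \<le> 4 * (4 * T * q ^ n - (u s e - v s e))"
        using s by (intro lly_curvature_diff_le[OF G Suc.prems(1)] Suc.IH) auto
      then show "u' s e - v' s e \<le> 4 * (4 * T * q ^ n - (u s e - v s e))"
        using w'[OF Suc.prems(1) s(1)] by simp
    qed (use Suc.prems init \<open>0 \<le> T\<close> q in auto)
    then show ?case by (simp add: q_def algebra_simps)
  qed
  have "(\<lambda>n. 4 * T * q ^ n) \<longlonglongrightarrow> 4 * T * 0"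
    using q by (intro tendsto_intros LIMSEQ_realpow_zero) auto
  then have "u T e - v T e \<le> 4 * T * 0"
    using bound[OF \<open>e \<in> E\<close>, of T] \<open>0 \<le> T\<close> by (intro LIMSEQ_le_const) auto
  then show ?thesis by simp
qed

section \<open>Limits of monotone functions and of derivatives\<close>

lemma mono_bounded_tendsto_at_top:
  fixes f :: "real \<Rightarrow> real"
  assumes mono: "\<And>s t. a \<le> s \<Longrightarrow> s \<le> t \<Longrightarrow> f s \<le> f t"
    and bound: "\<And>t. a \<le> t \<Longrightarrow> f t \<le> B"
  shows "\<exists>l. (f \<longlongrightarrow> l) at_top"
proof (intro exI order_tendstoI)
  have bdd: "bdd_above (f ` {a..})" using bound by (intro bdd_aboveI) auto
  fix c
  {
    assume "c < Sup (f ` {a..})"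
    then obtain s where s: "a \<le> s" "c < f s" using less_cSup_iff[OF _ bdd] by auto
    show "\<forall>\<^sub>F t in at_top. c < f t"
      using eventually_ge_at_top[of s]
      by eventually_elim (use s mono in \<open>force intro: less_le_trans\<close>)
  next
    assume c: "Sup (f ` {a..}) < c"
    show "\<forall>\<^sub>F t in at_top. f t < c"
      using eventually_ge_at_top[of a]
      by eventually_elim (use c cSUP_upper[OF _ bdd] in \<open>force intro: le_less_trans\<close>)
  }
qed

text \<open>The increment over \<open>[t, t + 1]\<close> tends to 0 and equals \<open>f'\<close> at
  a mean value point \<open>z t > t\<close>, which escapes to infinity.\<close>

lemma derivative_limit_eq_0:
  fixes f f' :: "real \<Rightarrow> real"
  assumes deriv: "\<And>t. a < t \<Longrightarrow> (f has_real_derivative f' t) (at t)"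
    and f: "(f \<longlongrightarrow> l) at_top" and f': "(f' \<longlongrightarrow> d) at_top"
  shows "d = 0"
proof -
  have "\<exists>z. t < z \<and> f (t + 1) - f t = f' z" if "a < t" for t
    using MVT2[of t "t + 1" f f'] deriv that by auto
  then obtain z where z: "\<And>t. a < t \<Longrightarrow> t < z t \<and> f (t + 1) - f t = f' (z t)" by metis
  have ev: "\<forall>\<^sub>F t in at_top. f (t + 1) - f t = f' (z t)"
    using eventually_gt_at_top[of a] by eventually_elim (use z in auto)
  have "filterlim z at_top at_top"
  proof (rule filterlim_at_top_mono[OF filterlim_ident])
    show "\<forall>\<^sub>F t in at_top. t \<le> z t"
      using eventually_gt_at_top[of a] by eventually_elim (use z less_imp_le in blast)
  qed
  then have "((\<lambda>t. f' (z t)) \<longlongrightarrow> d) at_top" by (rule filterlim_compose[OF f'])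
  then have "((\<lambda>t. f (t + 1) - f t) \<longlongrightarrow> d) at_top" using tendsto_cong[OF ev] by simp
  moreover have "((\<lambda>t. f (t + 1) - f t) \<longlongrightarrow> l - l) at_top"
    by (intro tendsto_intros f filterlim_compose[OF f]
        filterlim_at_top_mono[OF filterlim_ident always_eventually]) auto
  ultimately show ?thesis
    using tendsto_unique[OF trivial_limit_at_top_linorder] by fastforce
qed

theorem theorem1p5:
  fixes V :: "'a set" and E :: "'a set set"
    and \<kappa>s rs r0 :: "'a set \<Rightarrow> real" and r :: "real \<Rightarrow> 'a set \<Rightarrow> real"
  assumes "simple_graph V E"
    and "infinite V"
    and "connected_graph V E"
    and "locally_finite_graph V E"
    and "girth E \<ge> 6"
    and "rs \<in> linf E"
    and "\<forall>e\<in>E. lly_curvature E rs e = \<kappa>s e"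
    and "(bdd_above (r0 ` E) \<and> (\<forall>e\<in>E. lly_curvature E r0 e \<le> \<kappa>s e)) \<or>
         (bdd_below (r0 ` E) \<and> (\<forall>e\<in>E. lly_curvature E r0 e \<ge> \<kappa>s e))"
    and "ricci_flow_solution E \<kappa>s r0 r"
  shows "\<exists>rinf :: 'a set \<Rightarrow> real.
    (\<forall>e\<in>E. ((\<lambda>t. r t e) \<longlongrightarrow> rinf e) at_top) \<and>
    (\<forall>e\<in>E. lly_curvature E rinf e = \<kappa>s e) \<and>
    (bdd_above (r0 ` E) \<and> (\<forall>e\<in>E. lly_curvature E r0 e \<le> \<kappa>s e) \<longrightarrow>
       (\<forall>e\<in>E. rinf e \<le> (SUP e'\<in>E. r0 e') + 2 * linf_norm E rs)) \<and>
    (bdd_below (r0 ` E) \<and> (\<forall>e\<in>E. lly_curvature E r0 e \<ge> \<kappa>s e) \<longrightarrow>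
       (\<forall>e\<in>E. rinf e \<ge> (INF e'\<in>E. r0 e') - 2 * linf_norm E rs)) \<and>
    (\<forall>e\<in>E. ((\<lambda>t. lly_curvature E (r t) e) \<longlongrightarrow> \<kappa>s e) at_top)"
proof -
  note G = assms(1,4)
  note stationary = assms(7)
  let ?N = "linf_norm E rs"
  have r_0: "r 0 e = r0 e"
    and r_cont: "continuous_on {0..} (\<lambda>t. r t e)"
    and r_deriv: "0 < t \<Longrightarrow>
      ((\<lambda>t. r t e) has_real_derivative - lly_curvature E (r t) e + \<kappa>s e) (at t)"
    if "e \<in> E" for e t
    using assms(9) that unfolding ricci_flow_solution_def by auto
  \<comment> \<open>The equation is autonomous, so forward time shifts of the solution satisfy it as
    well.\<close>
  have shift_cont: "continuous_on {0..} (\<lambda>t. r (t + h) e)" if "e \<in> E" "0 \<le> h" for e h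
    using that by (intro continuous_on_compose2[OF r_cont] continuous_intros) auto
  have shift_deriv:
    "((\<lambda>t. r (t + h) e) has_real_derivative - lly_curvature E (r (t + h)) e + \<kappa>s e) (at t)"
    if "e \<in> E" "0 < t" "0 \<le> h" for e t h
    using r_deriv[of e "t + h"] that by (subst DERIV_shift[symmetric]) simp
  have rs_le: "\<bar>rs e\<bar> \<le> ?N" if "e \<in> E" for e
  proof -
    have "bdd_above ((\<lambda>e. \<bar>rs e\<bar>) ` E)"
      using assms(6) unfolding linf_def bounded_iff bdd_above_def by auto
    then show ?thesis unfolding linf_norm_def using that by (intro cSUP_upper)
  qed

  \<comment> \<open>Stationary barriers\<close>
  have upper: "r t e \<le> (SUP e'\<in>E. r0 e') + 2 * ?N"
    if bdd: "bdd_above (r0 ` E)" and "e \<in> E" "0 \<le> t" for t e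
  proof -
    \<comment> \<open>Adding \<open>?N\<close> to the supremum compensates for
      \<open>rs e \<ge> - ?N\<close>, so the barrier starts above \<open>r0\<close>. The bound
      \<open>rs e \<le> ?N\<close> costs the second \<open>?N\<close> at the end.\<close>
    let ?s = "\<lambda>e. rs e + ((SUP e'\<in>E. r0 e') + ?N)"
    have "r t e \<le> ?s e"
    proof (rule flow_comparison[OF G r_cont _ r_deriv, where v="\<lambda>_. ?s" and v'="\<lambda>_ _. 0"])
      fix e assume "e \<in> E"
      then show "r 0 e \<le> ?s e"
        using r_0 rs_le[of e] cSUP_upper[OF _ bdd] by fastforce
    qed (use that stationary in \<open>auto simp: lly_curvature_add_const\<close>)
    then show ?thesis using rs_le[OF \<open>e \<in> E\<close>] by simp
  qed
  have lower: "(INF e'\<in>E. r0 e') - 2 * ?N \<le> r t e"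
    if bdd: "bdd_below (r0 ` E)" and "e \<in> E" "0 \<le> t" for t e
  proof -
    let ?s = "\<lambda>e. rs e + ((INF e'\<in>E. r0 e') - ?N)"
    have "?s e \<le> r t e"
    proof (rule flow_comparison[OF G _ r_cont _ r_deriv, where u="\<lambda>_. ?s" and u'="\<lambda>_ _. 0"])
      fix e assume "e \<in> E"
      then show "?s e \<le> r 0 e"
        using r_0 rs_le[of e] cINF_lower[OF bdd] by fastforce
    qed (use that stationary in \<open>auto simp: lly_curvature_add_const\<close>)
    then show ?thesis using rs_le[OF \<open>e \<in> E\<close>] by simp
  qed

  \<comment> \<open>Monotonicity in time\<close>
  have incr: "r s e \<le> r t e"
    if sub: "\<forall>e\<in>E. lly_curvature E r0 e \<le> \<kappa>s e" and "e \<in> E" "0 \<le> s" "s \<le> t" for s t e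
  proof -
    have h: "0 \<le> t - s" using that by simp
    \<comment> \<open>The curvature inequality makes the right-hand side of the flow nonnegative at
      \<open>r0\<close>, so the constant \<open>r0\<close> is a subsolution. The shift by
      \<open>t - s\<close> thus starts above \<open>r\<close> and stays above it.\<close>
    have init: "r0 e \<le> r (t - s) e" if "e \<in> E" for e
      by (rule flow_comparison[OF G _ r_cont _ r_deriv, where u="\<lambda>_. r0" and u'="\<lambda>_ _. 0"])
        (use that sub h r_0 in auto)
    have "r s e \<le> r (s + (t - s)) e"
      by (rule flow_comparison[OF G r_cont shift_cont[OF _ h] r_deriv shift_deriv[OF _ _ h]])
        (use that r_0 init in auto)
    then show ?thesis by simp
  qed
  have decr: "r t e \<le> r s e"
    if super: "\<forall>e\<in>E. \<kappa>s e \<le> lly_curvature E r0 e" and "e \<in> E" "0 \<le> s" "s \<le> t" for s t e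
  proof -
    have h: "0 \<le> t - s" using that by simp
    have init: "r (t - s) e \<le> r0 e" if "e \<in> E" for e
      by (rule flow_comparison[OF G r_cont _ r_deriv, where v="\<lambda>_. r0" and v'="\<lambda>_ _. 0"])
        (use that super h r_0 in auto)
    have "r (s + (t - s)) e \<le> r s e"
      by (rule flow_comparison[OF G shift_cont[OF _ h] r_cont shift_deriv[OF _ _ h] r_deriv])
        (use that r_0 init in auto)
    then show ?thesis by simp
  qed

  \<comment> \<open>Convergence and identification of the limit\<close>
  have ex: "\<exists>l. ((\<lambda>t. r t e) \<longlongrightarrow> l) at_top" if "e \<in> E" for e
    using assms(8)
  proof (elim disjE conjE)
    assume "bdd_above (r0 ` E)" "\<forall>e\<in>E. lly_curvature E r0 e \<le> \<kappa>s e"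
    then show ?thesis
      using incr upper that by (intro mono_bounded_tendsto_at_top[where a=0]) auto
  next
    assume "bdd_below (r0 ` E)" "\<forall>e\<in>E. \<kappa>s e \<le> lly_curvature E r0 e"
    \<comment> \<open>Negation reduces the decreasing case to the increasing one.\<close>
    then have "- r s e \<le> - r t e" if "0 \<le> s" "s \<le> t" for s t
      using decr[OF _ \<open>e \<in> E\<close> that] by simp
    moreover have "- r t e \<le> - ((INF e'\<in>E. r0 e') - 2 * ?N)" if "0 \<le> t" for t
      using lower[OF \<open>bdd_below (r0 ` E)\<close> \<open>e \<in> E\<close> that] by simp
    ultimately obtain l where "((\<lambda>t. - r t e) \<longlongrightarrow> l) at_top"
      using mono_bounded_tendsto_at_top[of 0 "\<lambda>t. - r t e"] by blast
    then have "((\<lambda>t. r t e) \<longlongrightarrow> - l) at_top" by (simp flip: tendsto_minus_cancel_left)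
    then show ?thesis ..
  qed
  obtain rinf where lim: "((\<lambda>t. r t e) \<longlongrightarrow> rinf e) at_top" if "e \<in> E" for e
    using bchoice[of E "\<lambda>e l. ((\<lambda>t. r t e) \<longlongrightarrow> l) at_top"] ex by blast
  have curv: "((\<lambda>t. lly_curvature E (r t) e) \<longlongrightarrow> lly_curvature E rinf e) at_top" if "e \<in> E" for e
    using that lim by (rule tendsto_lly_curvature[OF G])
  have eq: "lly_curvature E rinf e = \<kappa>s e" if "e \<in> E" for e
  proof -
    \<comment> \<open>By the flow equation this expression is the time derivative of
      \<open>r\<close>, so its limit has to be 0.\<close>
    have deriv_lim: "((\<lambda>t. - lly_curvature E (r t) e + \<kappa>s e) \<longlongrightarrow> - lly_curvature E rinf e + \<kappa>s e) at_top"
      by (rule tendsto_add[OF tendsto_minus[OF curv[OF that]] tendsto_const])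
    have "- lly_curvature E rinf e + \<kappa>s e = 0"
      by (rule derivative_limit_eq_0[OF r_deriv[OF that] lim[OF that] deriv_lim])
    then show ?thesis by simp
  qed
  have nonneg: "\<forall>\<^sub>F t in at_top. 0 \<le> (t::real)" by (rule eventually_ge_at_top)
  have "rinf e \<le> (SUP e'\<in>E. r0 e') + 2 * ?N" if "bdd_above (r0 ` E)" "e \<in> E" for e
    by (rule tendsto_upperbound[OF lim[OF that(2)] eventually_mono[OF nonneg upper[OF that]]
          trivial_limit_at_top_linorder])
  moreover have "(INF e'\<in>E. r0 e') - 2 * ?N \<le> rinf e" if "bdd_below (r0 ` E)" "e \<in> E" for e
    by (rule tendsto_lowerbound[OF lim[OF that(2)] eventually_mono[OF nonneg lower[OF that]]
          trivial_limit_at_top_linorder])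
  moreover have "((\<lambda>t. lly_curvature E (r t) e) \<longlongrightarrow> \<kappa>s e) at_top" if "e \<in> E" for e
    using curv[OF that] eq[OF that] by simp
  ultimately show ?thesis
    using lim eq by (intro exI[of _ rinf] conjI impI ballI) simp_all
qed

end
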